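(* Let $\gamma$ be a planar curve and $\tilde\gamma$ its Bäcklund transformation (with some constant length parameter $L\neq 0$). If $\gamma$ is an elastic curve, then $\tilde\gamma$ is a 2-soliton.
   Context: Let $\gamma(t)$ be a planar curve parameterized by arc length, with Frenet frame $(T,N)$ and curvature $\kappa(t)$. A Bäcklund transformation of $\gamma$ is a curve $$\tilde\gamma(t)=\gamma(t)+L\big(\cos\beta(t)\,T(t)+\sin\beta(t)\,N(t)\big),$$ where $L\ne0$ is constant and $\beta(t)$ is a solution of $\frac{d\beta}{dt}=-\kappa(t)+\frac{2\sin\beta(t)}{L}$. (This ODE ensures that $t$ is also an arc length parameter on $\tilde\gamma$; the trivial alternative $\beta'=-\kappa$, which makes $\tilde\gamma$ a translate of $\gamma$, is set aside.) An elastic curve (elastica, 1-soliton) is a planar curve whose curvature, as a function of arc length, satisfies $\kappa''+\frac12\kappa^3+A\kappa=0$ for some constant $A$. A 2-soliton is a planar curve whose curvature, as a function of arc length, satisfies $aE_0+bE_2+E_4=0$ for some constants $a,b$, where $$E_0=\kappa,\quad E_2=\kappa''+\frac{\kappa^3}{2},\quad E_4=\kappa''''+\frac52\kappa^2\kappa''+\frac52\kappa(\kappa')^2+\frac38\kappa^5 .$$ *)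

theory Defs
  imports "HOL-Analysis.Analysis"
begin

text \<open>
  Parameters range over a nondegenerate interval \<open>I\<close>, which may be open or closed, bounded or
  unbounded. All derivatives are taken within \<open>I\<close>, i.e. they are one-sided at endpoints
  belonging to \<open>I\<close>.
\<close>

definition parameter_interval :: "real set \<Rightarrow> bool" where
  "parameter_interval I \<longleftrightarrow> is_interval I \<and> interior I \<noteq> {}"

primrec nth_derivative ::
    "nat \<Rightarrow> real set \<Rightarrow> (real \<Rightarrow> 'a::real_normed_vector) \<Rightarrow> real \<Rightarrow> 'a" where
  "nth_derivative 0 I f = f"
| "nth_derivative (Suc n) I f = (\<lambda>t. vector_derivative (nth_derivative n I f) (at t within I))"

definition times_differentiable_on ::
    "nat \<Rightarrow> (real \<Rightarrow> 'a::real_normed_vector) \<Rightarrow> real set \<Rightarrow> bool" where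
  "times_differentiable_on n f I \<longleftrightarrow> (\<forall>k<n. nth_derivative k I f differentiable_on I)"

definition tangent :: "real set \<Rightarrow> (real \<Rightarrow> real^2) \<Rightarrow> real \<Rightarrow> real^2" where
  "tangent I \<gamma> = nth_derivative 1 I \<gamma>"

text \<open>The normal is the tangent rotated by a quarter turn counterclockwise.\<close>

definition normal :: "real set \<Rightarrow> (real \<Rightarrow> real^2) \<Rightarrow> real \<Rightarrow> real^2" where
  "normal I \<gamma> t = vector [- tangent I \<gamma> t $ 2, tangent I \<gamma> t $ 1]"

definition arclength_curve :: "real set \<Rightarrow> (real \<Rightarrow> real^2) \<Rightarrow> bool" where
  "arclength_curve I \<gamma> \<longleftrightarrow>
     parameter_interval I \<and> times_differentiable_on 2 \<gamma> I \<and> (\<forall>t\<in>I. norm (tangent I \<gamma> t) = 1)"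

text \<open>
  Signed curvature. For an arc length parametrized curve \<open>T'\<close> is orthogonal to \<open>T\<close>, so this is
  the coefficient in the Frenet equation \<open>T' = \<kappa> N\<close>.
\<close>

definition curvature :: "real set \<Rightarrow> (real \<Rightarrow> real^2) \<Rightarrow> real \<Rightarrow> real" where
  "curvature I \<gamma> t = vector_derivative (tangent I \<gamma>) (at t within I) \<bullet> normal I \<gamma> t"

definition backlund_transformation ::
    "real set \<Rightarrow> real \<Rightarrow> (real \<Rightarrow> real^2) \<Rightarrow> (real \<Rightarrow> real^2) \<Rightarrow> bool" where
  "backlund_transformation I L \<gamma> \<gamma>' \<longleftrightarrow> L \<noteq> 0 \<and>
     (\<exists>\<beta>. (\<forall>t\<in>I. (\<beta> has_real_derivative - curvature I \<gamma> t + 2 * sin (\<beta> t) / L) (at t within I)) \<and>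
          (\<forall>t\<in>I. \<gamma>' t =
             \<gamma> t + L *\<^sub>R (cos (\<beta> t) *\<^sub>R tangent I \<gamma> t + sin (\<beta> t) *\<^sub>R normal I \<gamma> t)))"

definition E0 :: "real set \<Rightarrow> (real \<Rightarrow> real) \<Rightarrow> real \<Rightarrow> real" where
  "E0 I \<kappa> t = \<kappa> t"

definition E2 :: "real set \<Rightarrow> (real \<Rightarrow> real) \<Rightarrow> real \<Rightarrow> real" where
  "E2 I \<kappa> t = nth_derivative 2 I \<kappa> t + \<kappa> t ^ 3 / 2"

definition E4 :: "real set \<Rightarrow> (real \<Rightarrow> real) \<Rightarrow> real \<Rightarrow> real" where
  "E4 I \<kappa> t = nth_derivative 4 I \<kappa> t + 5 / 2 * \<kappa> t ^ 2 * nth_derivative 2 I \<kappa> t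
     + 5 / 2 * \<kappa> t * nth_derivative 1 I \<kappa> t ^ 2 + 3 / 8 * \<kappa> t ^ 5"

text \<open>
  The derivative operator is total, so the differentiability needed for the differential
  equations to be meaningful is stated explicitly.
\<close>

definition elastic_curve :: "real set \<Rightarrow> (real \<Rightarrow> real^2) \<Rightarrow> bool" where
  "elastic_curve I \<gamma> \<longleftrightarrow> arclength_curve I \<gamma> \<and> times_differentiable_on 2 (curvature I \<gamma>) I \<and>
     (\<exists>A. \<forall>t\<in>I. nth_derivative 2 I (curvature I \<gamma>) t + 1 / 2 * curvature I \<gamma> t ^ 3
                 + A * curvature I \<gamma> t = 0)"

definition two_soliton :: "real set \<Rightarrow> (real \<Rightarrow> real^2) \<Rightarrow> bool" where
  "two_soliton I \<gamma> \<longleftrightarrow> arclength_curve I \<gamma> \<and> times_differentiable_on 4 (curvature I \<gamma>) I \<and>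
     (\<exists>a b. \<forall>t\<in>I. a * E0 I (curvature I \<gamma>) t + b * E2 I (curvature I \<gamma>) t
                   + E4 I (curvature I \<gamma>) t = 0)"

end

theory Submission
  imports Defs
begin

text \<open>
  Write \<open>\<kappa>\<close> for the curvature and \<open>T\<close> for the tangent of \<open>\<gamma>\<close>, and put \<open>u = sin \<beta> / L\<close>,
  \<open>v = cos \<beta> / L\<close>. The vector from \<open>\<gamma>\<close> to the transformed curve is \<open>L\<close> times a unit
  vector at the angle \<open>\<beta>\<close> from \<open>T\<close>, which by the differential equation turns at rate
  \<open>\<kappa> + \<beta>' = 2 u\<close>. Its derivative is therefore perpendicular to it and of size \<open>2 sin \<beta>\<close>,
  which is just what turns \<open>T\<close> into its mirror image in the direction of that vector. So the
  transformed curve has unit speed, its tangent makes the angle \<open>2 \<beta>\<close> with \<open>T\<close>, and its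
  curvature is \<open>w = \<kappa> + 2 \<beta>' = 4 u - \<kappa>\<close> (lemma \<open>backlund_transformation_curvature\<close>).

  What remains concerns the autonomous system for \<open>(\<kappa>, \<kappa>', u, v)\<close> that the equation of
  the elastica and the equation for \<open>\<beta>\<close> form together. With \<open>m = u\<^sup>2 + v\<^sup>2 = 1 / L\<^sup>2\<close>, one has
  \<open>E2 w = 4 m w + F\<close> for the defect \<open>F = (A - 4 m) \<kappa> + 2 u \<kappa>\<^sup>2 - 4 v \<kappa>'\<close>, which vanishes when
  \<open>\<gamma>\<close> is a line. Since \<open>E4 w\<close> arises from the second derivative of \<open>E2 w\<close>, it remains to
  compute \<open>F''\<close> and to eliminate \<open>w'\<^sup>2\<close> by means of the conserved energy of the elastica.

  The coefficients can be predicted. Along the elastica the energy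
  \<open>C = \<kappa>'\<^sup>2 + \<kappa>^4 / 4 + A \<kappa>\<^sup>2\<close> is constant, and besides \<open>E2 \<kappa> + A E0 \<kappa> = 0\<close> it
  gives \<open>E4 \<kappa> + A E2 \<kappa> + (C / 2) E0 \<kappa> = 0\<close>. A line, which has \<open>\<kappa> = 0\<close>, is taken to a
  curve with \<open>E2 w = 4 m w\<close>. So the transformation should multiply the equation, read as
  a polynomial in the recursion that leads from \<open>E0\<close> to \<open>E2\<close> to \<open>E4\<close>, by the factor that
  belongs to the eigenvalue \<open>4 m\<close>:
  \<open>(E4 + A E2 + (C / 2) E0) - 4 m (E2 + A E0) = 0\<close>. This is the equation that \<open>w\<close> satisfies:
  \<open>b = A - 4 m\<close> and \<open>a = C / 2 - 4 m A\<close> (lemma \<open>two_soliton_equation_of_backlund_system\<close>).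
\<close>

section \<open>Iterated derivatives on an interval\<close>

lemma parameter_interval_at_within_neq_bot:
  assumes "parameter_interval I" "t \<in> I"
  shows "at t within I \<noteq> bot"
proof -
  have "I \<noteq> {x}" for x
    using assms(1) interior_singleton[of x] by (auto simp: parameter_interval_def)
  moreover have "connected I"
    using assms(1) by (simp add: parameter_interval_def is_interval_connected)
  ultimately have "t islimpt I"
    using assms(2) connected_imp_perfect by blast
  then show ?thesis
    by (simp add: trivial_limit_within)
qed

lemma vector_derivative_on_parameter_interval:
  assumes "parameter_interval I" "t \<in> I"
    and "(g has_vector_derivative y) (at t within I)" "\<And>s. s \<in> I \<Longrightarrow> f s = g s"
  shows "(f has_vector_derivative y) (at t within I)"
    and "vector_derivative f (at t within I) = y"
proof -
  show *: "(f has_vector_derivative y) (at t within I)"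
    by (rule has_vector_derivative_transform[OF assms(2) assms(4) assms(3)])
  show "vector_derivative f (at t within I) = y"
    using vector_derivative_within[OF parameter_interval_at_within_neq_bot[OF assms(1,2)] *] .
qed

text \<open>
  This reduces every computation of iterated derivatives to exhibiting the list of derivatives
  \<open>F 0, F 1, \<dots>, F n\<close>. Equality of \<open>f\<close> and \<open>F 0\<close> on the interval suffices because all derivatives
  are taken within it.
\<close>

lemma nth_derivative_eqI:
  assumes I: "parameter_interval I"
    and F: "\<And>j t. j < n \<Longrightarrow> t \<in> I \<Longrightarrow> (F j has_vector_derivative F (Suc j) t) (at t within I)"
    and f: "\<And>t. t \<in> I \<Longrightarrow> f t = F 0 t"
  shows "times_differentiable_on n f I"
    and "\<And>j t. j \<le> n \<Longrightarrow> t \<in> I \<Longrightarrow> nth_derivative j I f t = F j t"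
proof -
  show *: "nth_derivative j I f t = F j t" if "j \<le> n" "t \<in> I" for j t
    using that
  proof (induction j arbitrary: t)
    case 0
    then show ?case by (simp add: f)
  next
    case (Suc j)
    then show ?case
      using vector_derivative_on_parameter_interval(2)[OF I Suc.prems(2) F] by simp
  qed
  show "times_differentiable_on n f I"
    unfolding times_differentiable_on_def differentiable_on_def
    using vector_derivative_on_parameter_interval(1)[OF I _ F *] differentiableI_vector
    by (metis less_imp_le)
qed

lemma times_differentiable_on_has_vector_derivative:
  assumes "times_differentiable_on n f I" "j < n" "t \<in> I"
  shows "(nth_derivative j I f has_vector_derivative nth_derivative (Suc j) I f t) (at t within I)"
  using assms
  by (auto simp: times_differentiable_on_def differentiable_on_def vector_derivative_works)

section \<open>Rotations of the plane and moving frames\<close>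

definition quarter_turn :: "real^2 \<Rightarrow> real^2" where
  "quarter_turn x = vector [- x $ 2, x $ 1]"

definition rotation :: "real \<Rightarrow> real^2 \<Rightarrow> real^2" where
  "rotation \<phi> x = cos \<phi> *\<^sub>R x + sin \<phi> *\<^sub>R quarter_turn x"

lemma normal_eq_quarter_turn: "normal I \<gamma> t = quarter_turn (tangent I \<gamma> t)"
  by (simp add: normal_def quarter_turn_def)

lemma bounded_linear_quarter_turn: "bounded_linear quarter_turn"
  unfolding linear_conv_bounded_linear[symmetric]
  by (rule linearI) (simp_all add: quarter_turn_def vec_eq_iff forall_2)

lemma quarter_turn_quarter_turn: "quarter_turn (quarter_turn x) = - x"
  by (simp add: quarter_turn_def vec_eq_iff forall_2)

lemma inner_quarter_turn: "quarter_turn x \<bullet> quarter_turn y = x \<bullet> y"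
  by (simp add: quarter_turn_def inner_vec_def sum_2)

lemma inner_quarter_turn_self: "x \<bullet> quarter_turn x = 0"
  by (simp add: quarter_turn_def inner_vec_def sum_2)

lemma quarter_turn_rotation:
  "quarter_turn (rotation \<phi> x) = cos \<phi> *\<^sub>R quarter_turn x - sin \<phi> *\<^sub>R x"
  by (simp add: quarter_turn_def rotation_def vec_eq_iff forall_2)

lemma norm_rotation: "norm (rotation \<phi> x) = norm x"
proof -
  have "rotation \<phi> x \<bullet> rotation \<phi> x = (cos \<phi>)\<^sup>2 * (x \<bullet> x) + (sin \<phi>)\<^sup>2 * (x \<bullet> x)"
    using inner_quarter_turn_self[of x]
    by (simp add: rotation_def inner_add_left inner_add_right inner_quarter_turn
        inner_commute[of "quarter_turn x" x] power2_eq_square algebra_simps)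
  also have "\<dots> = x \<bullet> x"
    by (simp flip: distrib_right)
  finally show ?thesis
    by (simp add: norm_eq_sqrt_inner)
qed

lemma orthogonal_expansion_quarter_turn:
  assumes "norm e = 1"
  shows "x = (x \<bullet> e) *\<^sub>R e + (x \<bullet> quarter_turn e) *\<^sub>R quarter_turn e"
proof -
  have e: "e $ 1 * e $ 1 + e $ 2 * e $ 2 = 1"
    using assms by (simp add: norm_eq_1 inner_vec_def sum_2)
  have "x $ 1 = (x $ 1 * e $ 1 + x $ 2 * e $ 2) * e $ 1
      + (x $ 2 * e $ 1 - x $ 1 * e $ 2) * - e $ 2"
    and "x $ 2 = (x $ 1 * e $ 1 + x $ 2 * e $ 2) * e $ 2
      + (x $ 2 * e $ 1 - x $ 1 * e $ 2) * e $ 1"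
    using e by algebra+
  then show ?thesis
    by (simp add: quarter_turn_def vec_eq_iff forall_2 inner_vec_def sum_2 algebra_simps)
qed

text \<open>
  The curvature is defined as the normal component of the derivative of the tangent. It determines
  this derivative because a unit vector field has a derivative orthogonal to itself.
\<close>

lemma tangent_has_vector_derivative:
  assumes \<gamma>: "arclength_curve I \<gamma>" and t: "t \<in> I"
  shows "(tangent I \<gamma> has_vector_derivative curvature I \<gamma> t *\<^sub>R quarter_turn (tangent I \<gamma> t))
    (at t within I)"
proof -
  let ?T = "tangent I \<gamma>"
  define T' where "T' = vector_derivative ?T (at t within I)"
  have I: "parameter_interval I" and T1: "\<And>s. s \<in> I \<Longrightarrow> norm (?T s) = 1"
    using \<gamma> by (auto simp: arclength_curve_def)
  have D: "(?T has_vector_derivative T') (at t within I)"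
    using times_differentiable_on_has_vector_derivative[of 2 \<gamma> I 1 t] \<gamma> t
    by (simp add: arclength_curve_def tangent_def T'_def)
  have "((\<lambda>s. ?T s \<bullet> ?T s) has_vector_derivative ?T t \<bullet> T' + T' \<bullet> ?T t) (at t within I)"
    using bounded_bilinear.has_vector_derivative[OF bounded_bilinear_inner D D] .
  moreover have "((\<lambda>s. ?T s \<bullet> ?T s) has_vector_derivative 0) (at t within I)"
    by (rule vector_derivative_on_parameter_interval(1)[OF I t has_vector_derivative_const[of 1]])
      (use T1 in \<open>simp add: norm_eq_1\<close>)
  ultimately have "?T t \<bullet> T' + T' \<bullet> ?T t = 0"
    using vector_derivative_within[OF parameter_interval_at_within_neq_bot[OF I t]] by metis
  then have "T' \<bullet> ?T t = 0"
    by (simp add: inner_commute)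
  then have "T' = (T' \<bullet> quarter_turn (?T t)) *\<^sub>R quarter_turn (?T t)"
    using orthogonal_expansion_quarter_turn[OF T1[OF t], of T'] by simp
  then show ?thesis
    using D by (simp add: curvature_def normal_eq_quarter_turn T'_def)
qed

text \<open>
  If a vector turns at rate \<open>k\<close> and \<open>\<phi>\<close> is an angle measured from it, the rotated vector turns at
  rate \<open>k + \<phi>'\<close>. Applied with \<open>\<phi> = \<beta>\<close>, this gives the velocity of the segment between the
  two curves; applied with \<open>\<phi> = 2 \<beta>\<close>, the curvature of the transformed curve.
\<close>

lemma rotation_has_vector_derivative:
  assumes X: "(X has_vector_derivative k *\<^sub>R quarter_turn (X t)) (at t within I)"
    and \<phi>: "(\<phi> has_real_derivative d) (at t within I)"
  shows "((\<lambda>s. rotation (\<phi> s) (X s)) has_vector_derivative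
    (k + d) *\<^sub>R quarter_turn (rotation (\<phi> t) (X t))) (at t within I)"
proof -
  have JX: "((\<lambda>s. quarter_turn (X s)) has_vector_derivative k *\<^sub>R - X t) (at t within I)"
    using bounded_linear.has_vector_derivative[OF bounded_linear_quarter_turn X]
    by (simp add: linear_cmul[OF bounded_linear.linear[OF bounded_linear_quarter_turn]]
        quarter_turn_quarter_turn)
  have c: "((\<lambda>s. cos (\<phi> s)) has_real_derivative - sin (\<phi> t) * d) (at t within I)"
    and s: "((\<lambda>s. sin (\<phi> s)) has_real_derivative cos (\<phi> t) * d) (at t within I)"
    by (auto intro!: derivative_eq_intros \<phi>)
  have "((\<lambda>s. rotation (\<phi> s) (X s)) has_vector_derivative
      (cos (\<phi> t) *\<^sub>R k *\<^sub>R quarter_turn (X t) + (- sin (\<phi> t) * d) *\<^sub>R X t)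
      + (sin (\<phi> t) *\<^sub>R k *\<^sub>R - X t + (cos (\<phi> t) * d) *\<^sub>R quarter_turn (X t))) (at t within I)"
    unfolding rotation_def
    by (intro has_vector_derivative_add has_vector_derivative_scaleR c s X JX)
  then show ?thesis
    by (simp add: quarter_turn_rotation algebra_simps)
qed

text \<open>
  The first derivative of \<open>\<gamma>'\<close> is \<open>T + 2 sin \<beta> e\<close>, where \<open>e\<close> is the unit vector at angle
  \<open>\<beta> + \<pi> / 2\<close> from \<open>T\<close>. As \<open>T\<close> has component \<open>- sin \<beta>\<close> along \<open>e\<close>, only the sign of that component
  changes: \<open>T\<close> is reflected, and thus rotated by \<open>2 \<beta>\<close>.
\<close>

lemma backlund_transformation_curvature:
  assumes \<gamma>: "arclength_curve I \<gamma>" and L: "L \<noteq> 0"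
    and \<beta>: "\<And>t. t \<in> I \<Longrightarrow>
      (\<beta> has_real_derivative - curvature I \<gamma> t + 2 * sin (\<beta> t) / L) (at t within I)"
    and \<gamma>': "\<And>t. t \<in> I \<Longrightarrow>
      \<gamma>' t = \<gamma> t + L *\<^sub>R (cos (\<beta> t) *\<^sub>R tangent I \<gamma> t + sin (\<beta> t) *\<^sub>R normal I \<gamma> t)"
  shows "arclength_curve I \<gamma>'"
    and "\<And>t. t \<in> I \<Longrightarrow> curvature I \<gamma>' t = 4 * (sin (\<beta> t) / L) - curvature I \<gamma> t"
proof -
  let ?T = "tangent I \<gamma>" and ?\<kappa> = "curvature I \<gamma>"
  let ?T' = "\<lambda>s. rotation (2 * \<beta> s) (?T s)"
  let ?\<kappa>' = "\<lambda>s. 4 * (sin (\<beta> s) / L) - ?\<kappa> s"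
  have I: "parameter_interval I" and T1: "\<And>s. s \<in> I \<Longrightarrow> norm (?T s) = 1"
    using \<gamma> by (auto simp: arclength_curve_def)
  have \<gamma>'_rotation: "\<gamma>' t = \<gamma> t + L *\<^sub>R rotation (\<beta> t) (?T t)" if "t \<in> I" for t
    by (simp add: \<gamma>'[OF that] rotation_def normal_eq_quarter_turn)
  have D1: "((\<lambda>s. \<gamma> s + L *\<^sub>R rotation (\<beta> s) (?T s)) has_vector_derivative ?T' t) (at t within I)"
    if t: "t \<in> I" for t
  proof -
    have "(\<gamma> has_vector_derivative ?T t) (at t within I)"
      using times_differentiable_on_has_vector_derivative[of 2 \<gamma> I 0 t] \<gamma> t
      by (simp add: arclength_curve_def tangent_def)
    moreover have "((\<lambda>s. L *\<^sub>R rotation (\<beta> s) (?T s)) has_vector_derivative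
        L *\<^sub>R ((2 * sin (\<beta> t) / L) *\<^sub>R quarter_turn (rotation (\<beta> t) (?T t)))) (at t within I)"
      using bounded_linear.has_vector_derivative[OF bounded_linear_scaleR_right
          rotation_has_vector_derivative[OF tangent_has_vector_derivative[OF \<gamma> t] \<beta>[OF t]], of L]
      by (simp only: add_minus_cancel)
    ultimately have "((\<lambda>s. \<gamma> s + L *\<^sub>R rotation (\<beta> s) (?T s)) has_vector_derivative
        ?T t + (2 * sin (\<beta> t)) *\<^sub>R quarter_turn (rotation (\<beta> t) (?T t))) (at t within I)"
      using L by (auto dest: has_vector_derivative_add)
    moreover have "?T t + (2 * sin (\<beta> t)) *\<^sub>R quarter_turn (rotation (\<beta> t) (?T t)) = ?T' t"
      unfolding quarter_turn_rotation unfolding rotation_def sin_double cos_double_sin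
      by (simp add: power2_eq_square algebra_simps)
    ultimately show ?thesis by simp
  qed
  have D2: "(?T' has_vector_derivative ?\<kappa>' t *\<^sub>R quarter_turn (?T' t)) (at t within I)"
    if t: "t \<in> I" for t
  proof -
    have "((\<lambda>s. 2 * \<beta> s) has_real_derivative 2 * (- ?\<kappa> t + 2 * sin (\<beta> t) / L)) (at t within I)"
      by (intro DERIV_cmult \<beta> t)
    from rotation_has_vector_derivative[OF tangent_has_vector_derivative[OF \<gamma> t] this]
    show ?thesis by (simp add: algebra_simps)
  qed
  define F where "F = (\<lambda>j. [\<lambda>s. \<gamma> s + L *\<^sub>R rotation (\<beta> s) (?T s), ?T',
    \<lambda>s. ?\<kappa>' s *\<^sub>R quarter_turn (?T' s)] ! j)"
  have F: "(F j has_vector_derivative F (Suc j) t) (at t within I)" if "j < 2" "t \<in> I" for j t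
    using that D1 D2 by (auto simp: F_def less_Suc_eq numeral_2_eq_2)
  have \<gamma>'_F: "\<gamma>' t = F 0 t" if "t \<in> I" for t
    by (simp add: F_def \<gamma>'_rotation[OF that])
  have tangent: "tangent I \<gamma>' t = ?T' t" if "t \<in> I" for t
    using nth_derivative_eqI(2)[where n = 2 and F = F and f = \<gamma>' and j = 1, OF I F \<gamma>'_F _ that]
    by (simp add: F_def tangent_def)
  have "times_differentiable_on 2 \<gamma>' I"
    by (rule nth_derivative_eqI(1)[where n = 2 and F = F, OF I F \<gamma>'_F])
  then show "arclength_curve I \<gamma>'"
    using I T1 by (simp add: arclength_curve_def tangent norm_rotation)
  show "curvature I \<gamma>' t = ?\<kappa>' t" if t: "t \<in> I" for t
  proof -
    have "vector_derivative (tangent I \<gamma>') (at t within I) = ?\<kappa>' t *\<^sub>R quarter_turn (?T' t)"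
      using vector_derivative_on_parameter_interval(2)[OF I t D2[OF t] tangent] .
    moreover have "?T' t \<bullet> ?T' t = 1"
      using T1[OF t] norm_rotation by (metis norm_eq_1)
    ultimately show ?thesis
      by (simp add: curvature_def normal_eq_quarter_turn tangent t inner_quarter_turn)
  qed
qed

section \<open>The curvature equations\<close>

lemma elastica_energy_constant:
  fixes k p :: "real \<Rightarrow> real"
  assumes I: "parameter_interval I"
    and k: "\<And>t. t \<in> I \<Longrightarrow> (k has_real_derivative p t) (at t within I)"
    and p: "\<And>t. t \<in> I \<Longrightarrow> (p has_real_derivative - (k t ^ 3 / 2) - A * k t) (at t within I)"
  shows "\<exists>C. \<forall>t\<in>I. (p t)\<^sup>2 + k t ^ 4 / 4 + A * (k t)\<^sup>2 = C"
proof -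
  have "((\<lambda>s. (p s)\<^sup>2 + k s ^ 4 / 4 + A * (k s)\<^sup>2) has_real_derivative 0) (at t within I)"
    if t: "t \<in> I" for t
    by (auto intro!: derivative_eq_intros k[OF t] p[OF t]
        simp: field_simps power2_eq_square eval_nat_numeral)
  moreover have "convex I"
    using I by (simp add: parameter_interval_def is_interval_convex)
  ultimately show ?thesis
    using has_field_derivative_zero_constant[of I] by blast
qed

text \<open>
  In the autonomous system below, \<open>k\<close> and \<open>p = k'\<close> describe an elastica and \<open>(u, v)\<close> moves on a
  circle with angular velocity \<open>2 u - k\<close>; for the transformation of curves it is the pair
  \<open>(sin \<beta> / L, cos \<beta> / L)\<close>.

  Everything rests on \<open>E2 w = 4 m w + F\<close>. In terms of \<open>G = w'\<^sup>2 / 2 + w^4 / 8 - 2 m w\<^sup>2\<close>, the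
  identity \<open>E4 w = (E2 w)'' + w\<^sup>2 E2 w - w (w'\<^sup>2 / 2 + w^4 / 8)\<close> turns the claim into
  \<open>F'' + (A + w\<^sup>2) F = w (G - C / 2)\<close>, where \<open>C\<close> is the energy of the elastica. Both
  sides equal \<open>w ((2 u - k) F - (A / 2 + 2 m) k w)\<close>.
\<close>

lemma two_soliton_equation_of_backlund_system:
  fixes k p u v w :: "real \<Rightarrow> real"
  assumes I: "parameter_interval I"
    and k: "\<And>t. t \<in> I \<Longrightarrow> (k has_real_derivative p t) (at t within I)"
    and p: "\<And>t. t \<in> I \<Longrightarrow> (p has_real_derivative - (k t ^ 3 / 2) - A * k t) (at t within I)"
    and u: "\<And>t. t \<in> I \<Longrightarrow> (u has_real_derivative v t * (2 * u t - k t)) (at t within I)"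
    and v: "\<And>t. t \<in> I \<Longrightarrow> (v has_real_derivative - u t * (2 * u t - k t)) (at t within I)"
    and uv: "\<And>t. t \<in> I \<Longrightarrow> (u t)\<^sup>2 + (v t)\<^sup>2 = m"
    and w: "\<And>t. t \<in> I \<Longrightarrow> w t = 4 * u t - k t"
  shows "times_differentiable_on 4 w I"
    and "\<exists>a b. \<forall>t\<in>I. a * E0 I w t + b * E2 I w t + E4 I w t = 0"
proof -
  define F where "F t = (A - 4 * m) * k t + 2 * u t * (k t)\<^sup>2 - 4 * v t * p t" for t
  \<comment> \<open>\<open>F1\<close> and \<open>F2\<close> are the first two derivatives of \<open>F\<close>. \<open>F2\<close> is written in terms of \<open>F\<close> itself,
    which is possible on the circle \<open>u\<^sup>2 + v\<^sup>2 = m\<close>.\<close>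
  define F1 where "F1 t = (A - 4 * m + 8 * (u t)\<^sup>2) * p t + 4 * v t * k t * (u t * k t + A)" for t
  define F2 where "F2 t = - A * F t - 2 * u t * (4 * u t - k t) * F t
    - (A / 2 + 2 * m) * k t * (4 * u t - k t)\<^sup>2" for t
  \<comment> \<open>From the second derivative on, the derivatives of \<open>w\<close> are expressed by lower ones through the
    equation \<open>w'' + w^3 / 2 = 4 m w + F\<close>.\<close>
  define W where "W t = 4 * u t - k t" for t
  define W1 where "W1 t = 4 * v t * (2 * u t - k t) - p t" for t
  define W2 where "W2 t = 4 * m * W t + F t - W t ^ 3 / 2" for t
  define W3 where "W3 t = 4 * m * W1 t + F1 t - 3 / 2 * (W t)\<^sup>2 * W1 t" for t
  define W4 where "W4 t = 4 * m * W2 t + F2 t - 3 * W t * (W1 t)\<^sup>2 - 3 / 2 * (W t)\<^sup>2 * W2 t" for t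
  have DF: "(F has_real_derivative F1 t) (at t within I)" if t: "t \<in> I" for t
    unfolding F_def
    by (rule derivative_eq_intros k[OF t] p[OF t] u[OF t] v[OF t] refl)+
      (simp add: F1_def field_simps power2_eq_square eval_nat_numeral)
  have DF1: "(F1 has_real_derivative F2 t) (at t within I)" if t: "t \<in> I" for t
    unfolding F1_def
    apply (rule derivative_eq_intros k[OF t] p[OF t] u[OF t] v[OF t] refl)+
    unfolding F2_def F_def uv[OF t, symmetric]
    by (simp add: field_simps power2_eq_square eval_nat_numeral)
  have DW: "(W has_real_derivative W1 t) (at t within I)" if t: "t \<in> I" for t
    unfolding W_def
    by (rule derivative_eq_intros k[OF t] u[OF t] refl)+ (simp add: W1_def)
  have DW1: "(W1 has_real_derivative W2 t) (at t within I)" if t: "t \<in> I" for t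
    unfolding W1_def
    apply (rule derivative_eq_intros k[OF t] p[OF t] u[OF t] v[OF t] refl)+
    unfolding W2_def W_def F_def uv[OF t, symmetric]
    by (simp add: field_simps power2_eq_square eval_nat_numeral)
  have DW2: "(W2 has_real_derivative W3 t) (at t within I)" if t: "t \<in> I" for t
    unfolding W2_def
    by (auto intro!: derivative_eq_intros DW[OF t] DF[OF t] simp: W3_def)
  have DW3: "(W3 has_real_derivative W4 t) (at t within I)" if t: "t \<in> I" for t
    unfolding W3_def
    by (rule derivative_eq_intros DW[OF t] DW1[OF t] DF1[OF t] refl)+
      (simp add: W4_def power2_eq_square)
  define D where "D = (\<lambda>j. [W, W1, W2, W3, W4] ! j)"
  have D: "(D j has_vector_derivative D (Suc j) t) (at t within I)" if "j < 4" "t \<in> I" for j t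
    using that DW DW1 DW2 DW3
    by (auto simp: D_def less_Suc_eq eval_nat_numeral
        has_real_derivative_iff_has_vector_derivative[symmetric])
  have w0: "w t = D 0 t" if "t \<in> I" for t
    using w[OF that] by (simp add: D_def W_def)
  show "times_differentiable_on 4 w I"
    by (rule nth_derivative_eqI(1)[where n = 4 and F = D, OF I D w0])
  have derivs: "nth_derivative j I w t = D j t" if "j \<le> 4" "t \<in> I" for j t
    by (rule nth_derivative_eqI(2)[where n = 4 and F = D, OF I D w0 that])
  obtain C where C: "\<And>t. t \<in> I \<Longrightarrow> (p t)\<^sup>2 + k t ^ 4 / 4 + A * (k t)\<^sup>2 = C"
    using elastica_energy_constant[OF I k p] by blast
  have "(C / 2 - 4 * m * A) * E0 I w t + (A - 4 * m) * E2 I w t + E4 I w t = 0"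
    if t: "t \<in> I" for t
  proof -
    have E2: "E2 I w t = 4 * m * W t + F t"
      using derivs[of 2, OF _ t] w[OF t] by (simp add: E2_def D_def W2_def W_def)
    have E4: "E4 I w t = W4 t + 5 / 2 * (W t)\<^sup>2 * W2 t + 5 / 2 * W t * (W1 t)\<^sup>2 + 3 / 8 * W t ^ 5"
      using derivs[of 1, OF _ t] derivs[of 2, OF _ t] derivs[of 4, OF _ t] w[OF t]
      by (simp add: E4_def D_def W_def)
    \<comment> \<open>This is the evaluation of \<open>G - C / 2\<close>; in the last step it replaces \<open>C\<close>.\<close>
    have energy: "(W1 t)\<^sup>2 / 2 + W t ^ 4 / 8 - 2 * m * (W t)\<^sup>2 - C / 2
        = (2 * u t - k t) * F t - (A / 2 + 2 * m) * k t * W t"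
      unfolding W1_def W_def F_def uv[OF t, symmetric] C[OF t, symmetric]
      by (simp add: field_simps power2_eq_square eval_nat_numeral)
    have C2: "C / 2 = (W1 t)\<^sup>2 / 2 + W t ^ 4 / 8 - 2 * m * (W t)\<^sup>2
        - ((2 * u t - k t) * F t - (A / 2 + 2 * m) * k t * W t)"
      using energy by linarith
    have E0: "E0 I w t = W t"
      using w[OF t] by (simp add: E0_def W_def)
    have k_eq: "k t = 4 * u t - W t"
      by (simp add: W_def)
    have F2: "F2 t = - A * F t - 2 * u t * W t * F t - (A / 2 + 2 * m) * k t * (W t)\<^sup>2"
      by (simp add: F2_def W_def)
    show ?thesis
      unfolding E0 E2 E4 W4_def W2_def F2 C2 k_eq
      by (simp add: field_simps power2_eq_square eval_nat_numeral)
  qed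
  then show "\<exists>a b. \<forall>t\<in>I. a * E0 I w t + b * E2 I w t + E4 I w t = 0"
    by blast
qed

theorem theorem6:
  fixes I :: "real set" and L :: real and \<gamma> \<gamma>' :: "real \<Rightarrow> real^2"
  assumes "arclength_curve I \<gamma>"
    and "L \<noteq> 0"
    and "backlund_transformation I L \<gamma> \<gamma>'"
    and "elastic_curve I \<gamma>"
  shows "two_soliton I \<gamma>'"
proof -
  let ?\<kappa> = "curvature I \<gamma>"
  let ?\<kappa>1 = "nth_derivative 1 I ?\<kappa>"
  have I: "parameter_interval I"
    using assms(1) by (simp add: arclength_curve_def)
  obtain \<beta> where
    \<beta>: "\<And>t. t \<in> I \<Longrightarrow> (\<beta> has_real_derivative - ?\<kappa> t + 2 * sin (\<beta> t) / L) (at t within I)"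
    and \<gamma>': "\<And>t. t \<in> I \<Longrightarrow>
      \<gamma>' t = \<gamma> t + L *\<^sub>R (cos (\<beta> t) *\<^sub>R tangent I \<gamma> t + sin (\<beta> t) *\<^sub>R normal I \<gamma> t)"
    using assms(3) unfolding backlund_transformation_def by blast
  note transform = backlund_transformation_curvature[OF assms(1,2) \<beta> \<gamma>']
  obtain A where diff: "times_differentiable_on 2 ?\<kappa> I"
    and A: "\<And>t. t \<in> I \<Longrightarrow> nth_derivative 2 I ?\<kappa> t + 1 / 2 * ?\<kappa> t ^ 3 + A * ?\<kappa> t = 0"
    using assms(4) unfolding elastic_curve_def by blast
  have k: "(?\<kappa> has_real_derivative ?\<kappa>1 t) (at t within I)" if "t \<in> I" for t
    using times_differentiable_on_has_vector_derivative[OF diff _ that, of 0]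
    by (simp add: has_real_derivative_iff_has_vector_derivative)
  have p: "(?\<kappa>1 has_real_derivative - (?\<kappa> t ^ 3 / 2) - A * ?\<kappa> t) (at t within I)"
    if "t \<in> I" for t
  proof -
    have "nth_derivative 2 I ?\<kappa> t = - (?\<kappa> t ^ 3 / 2) - A * ?\<kappa> t"
      using A[OF that] by linarith
    then show ?thesis
      using times_differentiable_on_has_vector_derivative[OF diff _ that, of 1]
      by (simp add: has_real_derivative_iff_has_vector_derivative numeral_2_eq_2)
  qed
  have u: "((\<lambda>s. sin (\<beta> s) / L) has_real_derivative
      cos (\<beta> t) / L * (2 * (sin (\<beta> t) / L) - ?\<kappa> t)) (at t within I)" if "t \<in> I" for t
    using assms(2) by (auto intro!: derivative_eq_intros \<beta> that simp: field_simps)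
  have v: "((\<lambda>s. cos (\<beta> s) / L) has_real_derivative
      - (sin (\<beta> t) / L) * (2 * (sin (\<beta> t) / L) - ?\<kappa> t)) (at t within I)" if "t \<in> I" for t
    using assms(2) by (auto intro!: derivative_eq_intros \<beta> that simp: field_simps)
  have uv: "(sin (\<beta> t) / L)\<^sup>2 + (cos (\<beta> t) / L)\<^sup>2 = 1 / L\<^sup>2" for t
    by (simp add: power_divide add_divide_distrib[symmetric])
  show ?thesis
    unfolding two_soliton_def
    using transform(1) two_soliton_equation_of_backlund_system[OF I k p u v uv transform(2)]
    by blast
qed

end
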